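(* Let $T>0$ and $\alpha\in(0,1)$. The fractional derivative or the fractional primitive, of order $\alpha$, of a $T$-periodic function cannot be a $\tilde T$-periodic function, for any period $\tilde T$, with the exception of the zero function.
   Context: For $\alpha\in(0,1)$ and $f:\mathbb{R}\to\mathbb{R}$, the fractional integral (fractional primitive) of $f$ of order $\alpha$ is $$I^{\alpha}f(t)=\frac{1}{\Gamma(\alpha)}\int_0^t (t-s)^{\alpha-1}f(s)\,ds,$$ provided the right-hand side is defined for a.e. $t\in\mathbb{R}$. The fractional derivatives of order $\alpha$ considered are the Riemann–Liouville derivative $$D^{\alpha}f(t)=\frac{d}{dt}I^{1-\alpha}f(t)=\frac{1}{\Gamma(1-\alpha)}\frac{d}{dt}\int_0^t (t-s)^{-\alpha}f(s)\,ds$$ and the Caputo derivative $${}^{c}D^{\alpha}f(t)=I^{1-\alpha}f'(t)=\frac{1}{\Gamma(1-\alpha)}\int_0^t (t-s)^{-\alpha}f'(s)\,ds,$$ the latter being well defined, for example, for absolutely continuous functions. A function $g$ is $T$-periodic if $g(t+T)=g(t)$ for all $t$, and similarly for $\tilde T$. *)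

theory Defs
  imports "HOL-Analysis.Analysis"
begin

text \<open>
  Fractional operators with base point 0. The kernel \<open>(t - s) powr (\<alpha> - 1)\<close> is real only for
  \<open>s < t\<close>, so these operators are meaningful for \<open>t > 0\<close>; for \<open>t \<le> 0\<close> the integral below is 0
  and nothing is read off from it. Integrals are Lebesgue integrals; where one does not exist,
  the library value is 0, so the \<open>_defined\<close> predicates record that the operators make sense
  (almost everywhere).
\<close>

definition frac_int :: "real \<Rightarrow> (real \<Rightarrow> real) \<Rightarrow> real \<Rightarrow> real" where
  "frac_int \<alpha> f t = 1 / Gamma \<alpha> * (LINT s:{0..t}|lebesgue. (t - s) powr (\<alpha> - 1) * f s)"

definition frac_int_defined :: "real \<Rightarrow> (real \<Rightarrow> real) \<Rightarrow> bool" where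
  "frac_int_defined \<alpha> f \<longleftrightarrow>
     (AE t in lebesgue. 0 < t \<longrightarrow>
        set_integrable lebesgue {0..t} (\<lambda>s. (t - s) powr (\<alpha> - 1) * f s))"

definition RL_deriv :: "real \<Rightarrow> (real \<Rightarrow> real) \<Rightarrow> real \<Rightarrow> real" where
  "RL_deriv \<alpha> f t = deriv (frac_int (1 - \<alpha>) f) t"

definition RL_deriv_defined :: "real \<Rightarrow> (real \<Rightarrow> real) \<Rightarrow> bool" where
  "RL_deriv_defined \<alpha> f \<longleftrightarrow>
     frac_int_defined (1 - \<alpha>) f \<and>
     (AE t in lebesgue. 0 < t \<longrightarrow> frac_int (1 - \<alpha>) f differentiable (at t))"

definition caputo_deriv :: "real \<Rightarrow> (real \<Rightarrow> real) \<Rightarrow> real \<Rightarrow> real" where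
  "caputo_deriv \<alpha> f t = frac_int (1 - \<alpha>) (deriv f) t"

text \<open>Satisfied in particular by locally absolutely continuous \<open>f\<close>.\<close>

definition caputo_deriv_defined :: "real \<Rightarrow> (real \<Rightarrow> real) \<Rightarrow> bool" where
  "caputo_deriv_defined \<alpha> f \<longleftrightarrow>
     (AE t in lebesgue. f differentiable (at t)) \<and> frac_int_defined (1 - \<alpha>) (deriv f)"

text \<open>
  Periodicity of functions that are only defined for almost every \<open>t > 0\<close>. It is implied by
  \<open>g (t + T) = g t\<close> for all \<open>t\<close>, whatever values are chosen on \<open>t \<le> 0\<close> or on a null set.
\<close>

definition ae_periodic :: "real \<Rightarrow> (real \<Rightarrow> real) \<Rightarrow> bool" where
  "ae_periodic T g \<longleftrightarrow> (AE t in lebesgue. 0 < t \<longrightarrow> g (t + T) = g t)"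

end

theory Submission
  imports Defs "HOL-Complex_Analysis.Cauchy_Integral_Formula"
begin

text \<open>
  Write \<open>\<beta>\<close> for the order of the fractional integral involved (\<open>\<alpha>\<close> for the primitive, \<open>1 - \<alpha>\<close> for
  the two derivatives) and \<open>F\<close> for \<open>frac_int \<beta> f\<close>. The reason for the theorem is that a fractional
  integral never forgets the first period: splitting \<open>[0,t]\<close> at \<open>T\<close> and shifting the second piece
  back by one period gives, for almost every \<open>t > T\<close> (\<open>frac_int_difference\<close>),
  \<open>F t - F (t - T) = \<Phi> t\<close>, where \<open>\<Phi> t\<close> is a constant multiple of the integral of
  \<open>(t - s) powr (\<beta> - 1) * f s\<close> over \<open>0 \<le> s < T\<close>. This \<open>\<Phi>\<close> is smooth on \<open>t > T\<close>, and \<open>\<Phi>\<close> and \<open>\<Phi>'\<close>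
  tend to 0 at infinity, because \<open>\<beta> < 1\<close>. If \<open>F\<close> is \<open>T'\<close>-periodic, then so is \<open>\<Phi>\<close>, and a periodic
  function with limit 0 vanishes (\<open>vanishing_of_AE_periodic_difference\<close>).

  It remains to recover \<open>f\<close> from \<open>\<Phi>\<close>. The binomial series turns \<open>\<Phi> t\<close> into \<open>t powr (\<beta> - 1)\<close> times a
  power series in \<open>1 / t\<close> whose coefficients are the moments of \<open>f\<close> on \<open>[0,T)\<close>, multiplied by
  the numbers \<open>\<plusminus> ((\<beta> - 1) gchoose k)\<close> (\<open>kernel_integral_expansion\<close>). These are nonzero since
  \<open>\<beta> - 1\<close> is not a natural number, so \<open>\<Phi> = 0\<close> kills all moments, and an integrable function on a
  bounded interval with vanishing moments is 0 almost everywhere (\<open>AE_zero_of_moments_zero\<close>).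

  For the Riemann-Liouville derivative the same argument applies to \<open>F'\<close> and \<open>\<Phi>'\<close>. Here \<open>F\<close> is only
  differentiable almost everywhere, and might well have a singular part, so \<open>F\<close> cannot be
  reconstructed from \<open>F'\<close>. But only the difference \<open>F t - F (t - T)\<close> matters, and it agrees almost
  everywhere with the smooth function \<open>\<Phi>\<close>; thus \<open>\<Phi>' = 0\<close>, and \<open>\<Phi>\<close> is a constant, which must be its limit 0. The
  Caputo derivative of \<open>f\<close> is the fractional integral of \<open>deriv f\<close>, which is again periodic.
\<close>

section \<open>Properties valid almost everywhere on the real line\<close>

lemma AE_lebesgue_imp_limit_point:
  fixes x :: "'a::euclidean_space"
  assumes "AE y in lebesgue. P y"
  shows "x islimpt {y. P y}"
proof (rule islimptI)
  fix U :: "'a set" assume U: "x \<in> U" "open U"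
  have neg: "negligible {y. \<not> P y}"
  proof -
    from assms obtain N where "N \<in> null_sets lebesgue" "{y. \<not> P y} \<subseteq> N"
      by (auto simp: eventually_ae_filter)
    then show ?thesis
      by (meson negligible_iff_null_sets negligible_subset)
  qed
  have "\<not> U \<subseteq> insert x {y. \<not> P y}"
  proof
    assume "U \<subseteq> insert x {y. \<not> P y}"
    then have "negligible U" using neg by (meson negligible_insert negligible_subset)
    with U show False using open_not_negligible by auto
  qed
  then show "\<exists>y\<in>{y. P y}. y \<in> U \<and> y \<noteq> x" by auto
qed

lemma AE_lebesgue_within_nontrivial:
  fixes x :: "'a::euclidean_space"
  assumes "AE y in lebesgue. P y"
  shows "at x within {y. P y} \<noteq> bot"
  using AE_lebesgue_imp_limit_point[OF assms] by (simp add: trivial_limit_within)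

lemma AE_lebesgue_translate:
  fixes c :: real
  assumes "AE x in lebesgue. P x"
  shows "AE x in lebesgue. P (x + c)"
proof -
  from assms obtain N where N: "N \<in> null_sets lebesgue" "{y. \<not> P y} \<subseteq> N"
    by (auto simp: eventually_ae_filter)
  have "negligible ((+) (-c) ` N)" 
    using N(1) negligible_translation[of N "-c"] by (simp only: negligible_iff_null_sets)
  moreover have "{y. \<not> P (y + c)} \<subseteq> (+) (-c) ` N"
    using N(2) by (force simp: image_iff)
  ultimately show ?thesis
    unfolding negligible_iff_null_sets by (auto simp: eventually_ae_filter)
qed

text \<open>
  A set of full measure is dense, so limits at \<open>t\<close> may be computed along it. This is how
  identities that hold almost everywhere become identities at a given point.
\<close>

lemma continuous_zero_of_AE_zero:
  fixes \<Psi> :: "real \<Rightarrow> real"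
  assumes "isCont \<Psi> t" "T < t" and ae: "AE x in lebesgue. T < x \<longrightarrow> \<Psi> x = 0"
  shows "\<Psi> t = 0"
proof -
  let ?F = "at t within {x. T < x \<longrightarrow> \<Psi> x = 0}"
  have nt: "?F \<noteq> bot" by (rule AE_lebesgue_within_nontrivial[OF ae])
  have "(\<Psi> \<longlongrightarrow> \<Psi> t) ?F"
    using assms(1) unfolding isCont_def by (rule tendsto_within_subset) auto
  moreover have "eventually (\<lambda>x. \<Psi> x = 0) ?F"
  proof -
    have "eventually (\<lambda>x. T < x) (at t)"
      using assms(2) by (simp add: order_tendstoD(1)[OF tendsto_ident_at])
    then show ?thesis unfolding eventually_at_filter by (auto elim: eventually_mono)
  qed
  then have "(\<Psi> \<longlongrightarrow> 0) ?F" by (rule tendsto_eventually)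
  ultimately show ?thesis using nt by (rule tendsto_unique[rotated 1])
qed

text \<open>
  The difference quotients at \<open>t\<close> vanish along a set that accumulates at \<open>t\<close>. Differentiability
  is only needed at the one point \<open>t\<close>; this allows the identity for fractional integrals to be
  differentiated although it may fail on a null set.
\<close>

lemma derivative_zero_of_AE_zero:
  fixes Q :: "real \<Rightarrow> real"
  assumes D: "(Q has_real_derivative D) (at t)" "T < t"
    and ae: "AE x in lebesgue. T < x \<longrightarrow> Q x = 0"
  shows "D = 0"
proof -
  have Qt: "Q t = 0"
    using continuous_zero_of_AE_zero DERIV_isCont assms by blast
  let ?F = "at t within {x. T < x \<longrightarrow> Q x = 0}"
  have nt: "?F \<noteq> bot" by (rule AE_lebesgue_within_nontrivial[OF ae])
  have "((\<lambda>x. (Q x - Q t) / (x - t)) \<longlongrightarrow> D) ?F"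
    using D(1) unfolding has_field_derivative_iff by (rule tendsto_within_subset) auto
  moreover have "eventually (\<lambda>x. (Q x - Q t) / (x - t) = 0) ?F"
  proof -
    have "eventually (\<lambda>x. T < x) (at t)"
      using assms(2) by (simp add: order_tendstoD(1)[OF tendsto_ident_at])
    then show ?thesis unfolding eventually_at_filter Qt by (auto elim: eventually_mono)
  qed
  then have "((\<lambda>x. (Q x - Q t) / (x - t)) \<longlongrightarrow> 0) ?F" by (rule tendsto_eventually)
  ultimately show ?thesis using nt by (rule tendsto_unique[rotated 1])
qed

text \<open>
  The periodicity of \<open>G\<close> passes to \<open>\<Psi>\<close>. Hence \<open>\<Psi> t\<close> equals \<open>\<Psi> (t + n * T')\<close> for all \<open>n\<close>, and
  is the limit 0 of \<open>\<Psi>\<close> at infinity. Countably many null sets are discarded on the way, so that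
  continuity is needed to reach every \<open>t\<close>.
\<close>

lemma vanishing_of_AE_periodic_difference:
  fixes \<Psi> G :: "real \<Rightarrow> real"
  assumes T: "0 \<le> T" and T': "0 < T'"
    and cont: "\<And>t. T < t \<Longrightarrow> isCont \<Psi> t" and lim: "(\<Psi> \<longlongrightarrow> 0) at_top"
    and diff: "AE t in lebesgue. T < t \<longrightarrow> G t - G (t - T) = \<Psi> t"
    and per: "ae_periodic T' G"
    and t: "T < t"
  shows "\<Psi> t = 0"
proof (rule continuous_zero_of_AE_zero[OF cont[OF t] t])
  have per': "AE t in lebesgue. 0 < t \<longrightarrow> G (t + T') = G t"
    using per by (simp add: ae_periodic_def)
  have "AE t in lebesgue. T < t \<longrightarrow> \<Psi> (t + T') = \<Psi> t"
    using diff AE_lebesgue_translate[OF diff, of T'] per' AE_lebesgue_translate[OF per', of "-T"]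
  proof eventually_elim
    case (elim t)
    show ?case
    proof
      assume t: "T < t"
      have "\<Psi> (t + T') = G (t + T') - G (t + T' - T)" using elim(2) t T' by simp
      also have "G (t + T') = G t" using elim(3) t T by simp
      also have "t + T' - T = t + - T + T'" by simp
      also have "G \<dots> = G (t - T)" using elim(4) t by simp
      also have "G t - \<dots> = \<Psi> t" using elim(1) t by simp
      finally show "\<Psi> (t + T') = \<Psi> t" .
    qed
  qed
  then have "AE t in lebesgue. T < t + real n * T' \<longrightarrow>
      \<Psi> (t + real n * T' + T') = \<Psi> (t + real n * T')" for n
    by (rule AE_lebesgue_translate)
  then have "AE t in lebesgue. \<forall>n. T < t + real n * T' \<longrightarrow>
      \<Psi> (t + real n * T' + T') = \<Psi> (t + real n * T')"
    by (simp add: AE_all_countable)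
  then show "AE t in lebesgue. T < t \<longrightarrow> \<Psi> t = 0"
  proof eventually_elim
    case (elim t)
    show ?case
    proof
      assume t: "T < t"
      have "\<Psi> (t + real n * T') = \<Psi> t" for n
      proof (induction n)
        case (Suc n)
        have "0 \<le> real n * T'" using T' by simp
        then have "\<Psi> (t + real n * T' + T') = \<Psi> (t + real n * T')"
          using elim t by auto
        then show ?case using Suc by (simp add: algebra_simps)
      qed simp
      moreover have "filterlim (\<lambda>n. t + real n * T') at_top sequentially"
        using T' by (intro filterlim_tendsto_add_at_top[OF tendsto_const] filterlim_at_top_mult_tendsto_pos[OF tendsto_const] filterlim_real_sequentially)
      then have "(\<lambda>n. \<Psi> (t + real n * T')) \<longlonglongrightarrow> 0"
        by (rule filterlim_compose[OF lim])
      ultimately show "\<Psi> t = 0" using LIMSEQ_const_iff by auto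
    qed
  qed
qed

section \<open>Moments and power series\<close>

lemma integrable_mult_bounded_on_support:
  fixes h u :: "real \<Rightarrow> real"
  assumes h: "integrable lebesgue h" and supp: "\<And>s. s \<notin> S \<Longrightarrow> h s = 0"
    and u: "u \<in> borel_measurable lebesgue" and bound: "\<And>s. s \<in> S \<Longrightarrow> \<bar>u s\<bar> \<le> B"
  shows "integrable lebesgue (\<lambda>s. u s * h s)"
proof (rule Bochner_Integration.integrable_bound)
  show "integrable lebesgue (\<lambda>s. B * h s)" using h by simp
  show "(\<lambda>s. u s * h s) \<in> borel_measurable lebesgue"
    using u borel_measurable_integrable[OF h] by (rule borel_measurable_times)
  have "\<bar>u s\<bar> * \<bar>h s\<bar> \<le> \<bar>B\<bar> * \<bar>h s\<bar>" for s
    using bound[of s] supp[of s] by (cases "s \<in> S") (auto intro: mult_right_mono)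
  then show "AE s in lebesgue. norm (u s * h s) \<le> norm (B * h s)"
    by (simp add: abs_mult)
qed

text \<open>
  By linearity \<open>h\<close> is orthogonal to all polynomials. The bounded function \<open>sgn (h s)\<close> is almost
  everywhere a limit of continuous functions, hence by the Weierstrass theorem also of
  polynomials that stay bounded on \<open>[a,b]\<close>. In the limit the integral of \<open>sgn (h s) * h s\<close>, which
  is the integral of \<open>\<bar>h s\<bar>\<close>, is 0.
\<close>

lemma AE_zero_of_moments_zero:
  fixes h :: "real \<Rightarrow> real"
  assumes h: "integrable lebesgue h" and supp: "\<And>s. s \<notin> {a..b} \<Longrightarrow> h s = 0"
    and mom: "\<And>k. (\<integral>s. s ^ k * h s \<partial>lebesgue) = 0"
  shows "AE s in lebesgue. h s = 0"
proof -
  have hm [measurable]: "h \<in> borel_measurable lebesgue" using h by (rule borel_measurable_integrable)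
  have pow: "integrable lebesgue (\<lambda>s. s ^ k * h s)" for k
  proof (rule integrable_mult_bounded_on_support[OF h supp])
    show "(\<lambda>s::real. s ^ k) \<in> borel_measurable lebesgue"
      by (rule measurable_completion) simp
    fix s assume "s \<in> {a..b}"
    then have "\<bar>s\<bar> \<le> max \<bar>a\<bar> \<bar>b\<bar>" by auto
    then show "\<bar>s ^ k\<bar> \<le> max \<bar>a\<bar> \<bar>b\<bar> ^ k" by (simp add: power_abs power_mono)
  qed
  have poly: "(\<integral>s. p s * h s \<partial>lebesgue) = 0" "integrable lebesgue (\<lambda>s. p s * h s)"
    if pf: "real_polynomial_function p" for p
  proof -
    obtain c n where p: "p = (\<lambda>x. \<Sum>i\<le>(n::nat). c i * x ^ i)"
      using real_polynomial_function_imp_sum[OF pf] by blast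
    have eq: "(\<lambda>s. p s * h s) = (\<lambda>s. \<Sum>i\<le>n. c i * (s ^ i * h s))"
      by (simp add: p sum_distrib_right mult.assoc)
    show "(\<integral>s. p s * h s \<partial>lebesgue) = 0" "integrable lebesgue (\<lambda>s. p s * h s)"
      unfolding eq using pow mom by (simp_all add: Bochner_Integration.integral_sum)
  qed
  have "(\<lambda>s. sgn (h s)) \<in> borel_measurable lebesgue" 
    by (auto intro!: measurable_compose[OF hm])
  then have "(\<lambda>s. sgn (h s)) measurable_on UNIV"
    by (rule lebesgue_measurable_imp_measurable_on) simp
  then obtain N g where N: "negligible N" and g: "\<And>n. continuous_on UNIV (g n)"
    and lim: "\<And>s. s \<notin> N \<Longrightarrow> (\<lambda>n. g n s) \<longlonglongrightarrow> sgn (h s)"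
    unfolding measurable_on_def by auto
  \<comment> \<open>Clipping to \<open>[-1,1]\<close> does not affect the limit \<open>sgn (h s)\<close> and provides a dominating function.\<close>
  define g' where "g' n s = max (-1) (min 1 (g n s))" for n :: nat and s :: real
  have "\<exists>p. real_polynomial_function p \<and> (\<forall>s\<in>{a..b}. \<bar>g' n s - p s\<bar> < inverse (real (Suc n)))" for n
  proof -
    have "continuous_on {a..b} (g' n)"
      unfolding g'_def by (intro continuous_intros continuous_on_subset[OF g]) auto
    then show ?thesis
      by (metis Stone_Weierstrass_real_polynomial_function[of "{a..b}" "g' n"] compact_Icc
        inverse_positive_iff_positive of_nat_0_less_iff zero_less_Suc)
  qed
  then obtain p where p: "\<And>n. real_polynomial_function (p n)"
    and close: "\<And>n s. s \<in> {a..b} \<Longrightarrow> \<bar>g' n s - p n s\<bar> < inverse (real (Suc n))"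
    by metis
  have "(\<lambda>n. \<integral>s. p n s * h s \<partial>lebesgue) \<longlonglongrightarrow> (\<integral>s. sgn (h s) * h s \<partial>lebesgue)"
  proof (rule integral_dominated_convergence)
    show "(\<lambda>s. sgn (h s) * h s) \<in> borel_measurable lebesgue"
      using \<open>(\<lambda>s. sgn (h s)) \<in> _\<close> hm by (rule borel_measurable_times)
    show "(\<lambda>s. p n s * h s) \<in> borel_measurable lebesgue" for n
      using poly(2)[OF p] by (rule borel_measurable_integrable)
    show "integrable lebesgue (\<lambda>s. 2 * \<bar>h s\<bar>)" using h by simp
    show "AE s in lebesgue. norm (p n s * h s) \<le> 2 * \<bar>h s\<bar>" for n
    proof (rule AE_I2)
      fix s
      show "norm (p n s * h s) \<le> 2 * \<bar>h s\<bar>"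
      proof (cases "s \<in> {a..b}")
        case True
        have "inverse (real (Suc n)) \<le> 1" by (simp add: divide_simps)
        moreover have "\<bar>g' n s\<bar> \<le> 1" by (auto simp: g'_def)
        ultimately have "\<bar>p n s\<bar> \<le> 2" using close[OF True, of n] by linarith
        then show ?thesis by (simp add: abs_mult mult_right_mono)
      qed (simp add: supp)
    qed
    have "AE s in lebesgue. s \<notin> N"
      using N by (simp add: negligible_iff_null_sets AE_not_in)
    then show "AE s in lebesgue. (\<lambda>n. p n s * h s) \<longlonglongrightarrow> sgn (h s) * h s"
    proof eventually_elim
      case (elim s)
      show ?case
      proof (cases "s \<in> {a..b}")
        case True
        have "(\<lambda>n. g' n s) \<longlonglongrightarrow> max (-1) (min 1 (sgn (h s)))"
          unfolding g'_def using lim[OF elim] by (intro tendsto_intros)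
        also have "max (-1) (min 1 (sgn (h s))) = sgn (h s)" by (auto simp: sgn_if)
        finally have 1: "(\<lambda>n. g' n s) \<longlonglongrightarrow> sgn (h s)" .
        have "(\<lambda>n. g' n s - p n s) \<longlonglongrightarrow> 0"
          by (rule Lim_null_comparison[OF _ LIMSEQ_inverse_real_of_nat])
             (use close[OF True] in \<open>auto intro!: always_eventually less_imp_le\<close>)
        from tendsto_diff[OF 1 this] show ?thesis by (intro tendsto_intros) simp
      qed (simp add: supp)
    qed
  qed
  then have "(\<integral>s. sgn (h s) * h s \<partial>lebesgue) = 0"
    using poly(1)[OF p] by (simp add: LIMSEQ_const_iff)
  then have "(\<integral>s. \<bar>h s\<bar> \<partial>lebesgue) = 0"
    by (simp add: abs_sgn mult.commute)
  then show ?thesis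
    using integral_nonneg_eq_0_iff_AE[of lebesgue "\<lambda>s. \<bar>h s\<bar>"] h by simp
qed

text \<open>
  A one-sided version of the identity theorem: the variable will be \<open>1 / t\<close>, which is positive.
  It suffices that the zeros of a nonzero power series cannot accumulate at the centre.
\<close>

lemma power_series_coeffs_zero:
  fixes a :: "nat \<Rightarrow> real"
  assumes r: "0 < r" and sm: "\<And>x. \<bar>x\<bar> < r \<Longrightarrow> summable (\<lambda>k. a k * x ^ k)"
    and zero: "\<And>x. 0 < x \<Longrightarrow> x < r \<Longrightarrow> (\<Sum>k. a k * x ^ k) = 0"
  shows "a k = 0"
proof -
  let ?P = "\<lambda>x. \<Sum>k. a k * x ^ k"
  have sums: "norm x < r \<Longrightarrow> (\<lambda>k. a k * x ^ k) sums ?P x" for x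
    using sm by (simp add: summable_sums)
  have ev: "\<forall>\<^sub>F x in at_right 0. ?P x = 0"
    using r zero by (auto simp: eventually_at_right_field intro!: exI[of _ r])
  \<comment> \<open>The constant coefficient is treated separately, because \<open>powser_0_nonzero\<close> presupposes a zero at the centre.\<close>
  have "(?P \<longlongrightarrow> a 0) (at 0)" by (rule powser_limit_0[OF r sums])
  then have "(?P \<longlongrightarrow> a 0) (at_right 0)" by (rule tendsto_within_subset) simp
  moreover have "(?P \<longlongrightarrow> 0) (at_right 0)" using ev by (rule tendsto_eventually)
  ultimately have a0: "a 0 = 0" using tendsto_unique trivial_limit_at_right_real by blast
  show ?thesis
  proof (rule ccontr)
    assume ak: "a k \<noteq> 0"
    with a0 have "k > 0" by (cases k) auto
    have "?P 0 = 0" using a0 by simp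
    with powser_0_nonzero[of r 0 a ?P k] r sums ak \<open>k > 0\<close> obtain s
      where s: "0 < s" "\<And>z. z \<in> cball 0 s - {0} \<Longrightarrow> ?P z \<noteq> 0" by auto
    define z where "z = min s (r / 2)"
    have "0 < z" "z < r" "z \<le> s" using s(1) r by (auto simp: z_def)
    then show False using s(2)[of z] zero[of z] by auto
  qed
qed

section \<open>Integrals against a power kernel\<close>

text \<open>
  The coefficient of \<open>t powr b * (1 / t) ^ k\<close> when \<open>(t - s) powr b\<close> is expanded by the binomial series
  for large \<open>t\<close> and integrated against \<open>h\<close>.
\<close>

definition kernel_coeff :: "real \<Rightarrow> (real \<Rightarrow> real) \<Rightarrow> nat \<Rightarrow> real" where
  "kernel_coeff b h k = (b gchoose k) * (-1) ^ k * (\<integral>s. s ^ k * h s \<partial>lebesgue)"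

lemma summable_gchoose:
  fixes b x :: real
  assumes "\<bar>x\<bar> < 1"
  shows "summable (\<lambda>k. \<bar>(b gchoose k) * x ^ k\<bar>)"
  using abs_summable_in_conv_radius[of x "\<lambda>k. b gchoose k"] assms
  by (simp add: conv_radius_gchoose split: if_splits)

context
  fixes h :: "real \<Rightarrow> real" and T :: real
  assumes h: "integrable lebesgue h" and supp: "\<And>s. s \<notin> {0..T} \<Longrightarrow> h s = 0" and T: "0 < T"
begin

lemma integrable_power_mult: "integrable lebesgue (\<lambda>s. s ^ k * h s)"
proof (rule integrable_mult_bounded_on_support[OF h supp])
  show "(\<lambda>s::real. s ^ k) \<in> borel_measurable lebesgue"
    by (rule measurable_completion) simp
  show "\<bar>s ^ k\<bar> \<le> T ^ k" if "s \<in> {0..T}" for s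
    using that by (simp add: power_abs power_mono)
qed

lemma power_mult_bound: "\<bar>s ^ k * h s\<bar> \<le> T ^ k * \<bar>h s\<bar>"
  using supp[of s] by (cases "s \<in> {0..T}") (auto simp: abs_mult power_abs intro!: mult_right_mono power_mono)

lemma moment_bound: "(\<integral>s. \<bar>s ^ k * h s\<bar> \<partial>lebesgue) \<le> T ^ k * (\<integral>s. \<bar>h s\<bar> \<partial>lebesgue)"
proof -
  have "(\<integral>s. \<bar>s ^ k * h s\<bar> \<partial>lebesgue) \<le> (\<integral>s. T ^ k * \<bar>h s\<bar> \<partial>lebesgue)"
    by (rule integral_mono) (use h integrable_power_mult power_mult_bound in auto)
  then show ?thesis by simp
qed

lemma summable_kernel_coeff:
  assumes x: "\<bar>x\<bar> < 1 / T"
  shows "summable (\<lambda>k. kernel_coeff b h k * x ^ k)"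
proof (rule summable_comparison_test)
  have "\<bar>T * x\<bar> < 1" using x T by (simp add: abs_mult field_simps)
  then show "summable (\<lambda>k. \<bar>(b gchoose k) * (T * x) ^ k\<bar> * (\<integral>s. \<bar>h s\<bar> \<partial>lebesgue))"
    by (intro summable_mult2 summable_gchoose)
  show "\<exists>N. \<forall>k\<ge>N. norm (kernel_coeff b h k * x ^ k)
          \<le> \<bar>(b gchoose k) * (T * x) ^ k\<bar> * (\<integral>s. \<bar>h s\<bar> \<partial>lebesgue)"
  proof (intro exI allI impI)
    fix k
    have "\<bar>\<integral>s. s ^ k * h s \<partial>lebesgue\<bar> \<le> T ^ k * (\<integral>s. \<bar>h s\<bar> \<partial>lebesgue)"
      using moment_bound[of k] integral_abs_bound[of lebesgue "\<lambda>s. s ^ k * h s"] by linarith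
    then have "\<bar>b gchoose k\<bar> * \<bar>x\<bar> ^ k * \<bar>\<integral>s. s ^ k * h s \<partial>lebesgue\<bar>
        \<le> \<bar>b gchoose k\<bar> * \<bar>x\<bar> ^ k * (T ^ k * (\<integral>s. \<bar>h s\<bar> \<partial>lebesgue))"
      by (rule mult_left_mono) simp
    then show "norm (kernel_coeff b h k * x ^ k)
          \<le> \<bar>(b gchoose k) * (T * x) ^ k\<bar> * (\<integral>s. \<bar>h s\<bar> \<partial>lebesgue)"
      using T by (simp add: kernel_coeff_def abs_mult power_abs power_mult_distrib mult_ac)
  qed
qed

text \<open>
  For \<open>0 \<le> s \<le> T < t\<close> one has \<open>(t - s) powr b = t powr b * (1 - s / t) powr b\<close>, and the binomial series
  of the second factor is dominated, uniformly in \<open>s\<close>, by the absolutely convergent series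
  with \<open>T / t\<close> in place of \<open>s / t\<close>. So integration against \<open>h\<close> may be done term by term.
\<close>

lemma kernel_integral_expansion:
  assumes t: "T < t"
  shows "(\<integral>s. (t - s) powr b * h s \<partial>lebesgue)
           = t powr b * (\<Sum>k. kernel_coeff b h k * (1 / t) ^ k)"
proof -
  have t0: "0 < t" using T t by simp
  define F where "F k s = (t powr b * (b gchoose k) * (- 1 / t) ^ k) * (s ^ k * h s)" for k s
  have Tt: "\<bar>T / t\<bar> < 1" using T t by simp
  have F_bound: "norm (F k s) \<le> t powr b * (\<bar>(b gchoose k) * (T / t) ^ k\<bar> * \<bar>h s\<bar>)" for k s
  proof -
    have "norm (F k s) = (t powr b * \<bar>b gchoose k\<bar> * (1 / t) ^ k) * \<bar>s ^ k * h s\<bar>"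
      using t0 by (simp add: F_def abs_mult power_abs power_divide)
    also have "\<dots> \<le> (t powr b * \<bar>b gchoose k\<bar> * (1 / t) ^ k) * (T ^ k * \<bar>h s\<bar>)"
      by (rule mult_left_mono[OF power_mult_bound]) (use t0 in simp)
    also have "\<dots> = t powr b * (\<bar>(b gchoose k) * (T / t) ^ k\<bar> * \<bar>h s\<bar>)"
      using t0 T by (simp add: abs_mult power_abs power_divide)
    finally show ?thesis .
  qed
  have F_int: "integrable lebesgue (F k)" for k
    unfolding F_def using integrable_power_mult by simp
  have F_summable: "summable (\<lambda>k. norm (F k s))" for s
    by (rule summable_comparison_test'[OF summable_mult[OF summable_mult2[OF summable_gchoose[OF Tt]]]])
       (use F_bound in simp)
  have F_summable': "summable (\<lambda>k. \<integral>s. norm (F k s) \<partial>lebesgue)"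
  proof (rule summable_comparison_test'[OF summable_mult[OF summable_mult2[OF summable_gchoose[OF Tt]]]])
    fix k
    have "(\<integral>s. norm (F k s) \<partial>lebesgue)
        \<le> (\<integral>s. t powr b * (\<bar>(b gchoose k) * (T / t) ^ k\<bar> * \<bar>h s\<bar>) \<partial>lebesgue)"
      by (rule integral_mono) (use F_int h F_bound in auto)
    then show "norm (\<integral>s. norm (F k s) \<partial>lebesgue)
        \<le> t powr b * (\<bar>(b gchoose k) * (T / t) ^ k\<bar> * (\<integral>s. \<bar>h s\<bar> \<partial>lebesgue))"
      by simp
  qed
  have "(\<lambda>k. integral\<^sup>L lebesgue (F k)) sums (\<integral>s. (\<Sum>k. F k s) \<partial>lebesgue)"
    by (rule sums_integral[OF F_int AE_I2[OF F_summable] F_summable'])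
  moreover have "(\<Sum>k. F k s) = (t - s) powr b * h s" for s
  proof (cases "s \<in> {0..T}")
    case True
    then have "\<bar>- s / t\<bar> < 1" using t t0 by auto
    then have "(\<lambda>k. (b gchoose k) * (- s / t) ^ k) sums (1 + - s / t) powr b"
      by (rule gen_binomial_real)
    then have "(\<lambda>k. t powr b * h s * ((b gchoose k) * (- s / t) ^ k))
        sums (t powr b * h s * (1 + - s / t) powr b)"
      by (rule sums_mult)
    moreover have "t powr b * h s * ((b gchoose k) * (- s / t) ^ k) = F k s" for k
      by (simp add: F_def power_divide power_minus')
    moreover have "t powr b * (1 + - s / t) powr b = (t - s) powr b"
    proof -
      have "t * (1 + - s / t) = t - s" using t0 by (simp add: field_simps)
      then show ?thesis using t0 True t by (simp add: powr_mult[symmetric])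
    qed
    ultimately have "(\<lambda>k. F k s) sums ((t - s) powr b * h s)"
      by (simp add: mult_ac)
    then show ?thesis by (rule sums_unique[symmetric])
  qed (simp add: F_def supp)
  moreover have "integral\<^sup>L lebesgue (F k) = t powr b * (kernel_coeff b h k * (1 / t) ^ k)" for k
  proof -
    have "(- 1 / t) ^ k = (- 1) ^ k * (1 / t) ^ k" by (simp add: power_mult_distrib[symmetric])
    then show ?thesis
      unfolding F_def kernel_coeff_def integral_mult_right_zero by (simp only: mult_ac)
  qed
  ultimately have "(\<lambda>k. t powr b * (kernel_coeff b h k * (1 / t) ^ k))
      sums (\<integral>s. (t - s) powr b * h s \<partial>lebesgue)" by simp
  moreover have "(\<lambda>k. t powr b * (kernel_coeff b h k * (1 / t) ^ k))
      sums (t powr b * (\<Sum>k. kernel_coeff b h k * (1 / t) ^ k))"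
    by (intro sums_mult summable_sums summable_kernel_coeff) (use t t0 T in \<open>simp add: frac_less2\<close>)
  ultimately show ?thesis by (rule sums_unique2)
qed

text \<open>
  The moments of \<open>h\<close> can be read off from the coefficients, since no binomial coefficient
  \<open>b gchoose k\<close> is 0 unless \<open>b\<close> is a natural number.
\<close>

lemma AE_zero_of_kernel_integral_zero:
  assumes b: "b \<notin> \<nat>" and zero: "\<And>t. T < t \<Longrightarrow> (\<integral>s. (t - s) powr b * h s \<partial>lebesgue) = 0"
  shows "AE s in lebesgue. h s = 0"
proof (rule AE_zero_of_moments_zero[OF h supp])
  fix k
  have "kernel_coeff b h k = 0"
  proof (rule power_series_coeffs_zero)
    show "0 < 1 / T" using T by simp
    show "summable (\<lambda>k. kernel_coeff b h k * x ^ k)" if "\<bar>x\<bar> < 1 / T" for x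
      using that by (rule summable_kernel_coeff)
    show "(\<Sum>k. kernel_coeff b h k * x ^ k) = 0" if "0 < x" "x < 1 / T" for x
    proof -
      have "T < 1 / x" using that T by (simp add: field_simps)
      from kernel_integral_expansion[OF this, of b] zero[OF this] show ?thesis using that by simp
    qed
  qed
  moreover have "b gchoose k \<noteq> 0"
    using b by (auto simp: gbinomial_prod_rev Nats_def)
  ultimately show "(\<integral>s. s ^ k * h s \<partial>lebesgue) = 0"
    by (simp add: kernel_coeff_def)
qed

text \<open>
  Everything is read off from \<open>t powr b * P (1 / t)\<close> with \<open>P\<close> the power series of the expansion. Both
  this function and its derivative decay because \<open>P\<close> and \<open>P'\<close> are bounded near 0 and \<open>b < 0\<close>.
\<close>

lemma kernel_integral_derivative:
  assumes b: "b < 0"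
  obtains \<Phi>' where
    "\<And>t. T < t \<Longrightarrow> ((\<lambda>t. \<integral>s. (t - s) powr b * h s \<partial>lebesgue) has_real_derivative \<Phi>' t) (at t)"
    "\<And>t. T < t \<Longrightarrow> isCont \<Phi>' t" "(\<Phi>' \<longlongrightarrow> 0) at_top"
    "((\<lambda>t. \<integral>s. (t - s) powr b * h s \<partial>lebesgue) \<longlongrightarrow> 0) at_top"
proof -
  let ?\<Phi> = "\<lambda>t. \<integral>s. (t - s) powr b * h s \<partial>lebesgue"
  let ?a = "kernel_coeff b h"
  define P where "P x = (\<Sum>k. ?a k * x ^ k)" for x
  define P' where "P' x = (\<Sum>k. diffs ?a k * x ^ k)" for x
  define \<Phi>' where "\<Phi>' t = b * t powr (b - 1) * P (1 / t) + t powr b * (P' (1 / t) * (- 1 / t\<^sup>2))" for t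
  have sm: "norm x < 1 / T \<Longrightarrow> summable (\<lambda>k. ?a k * x ^ k)" for x
    using summable_kernel_coeff by simp
  have sm': "norm x < 1 / T \<Longrightarrow> summable (\<lambda>k. diffs ?a k * x ^ k)" for x
    by (rule termdiff_converges[OF _ sm])
  have P_deriv: "(P has_real_derivative P' x) (at x)" if "norm x < 1 / T" for x
    unfolding P_def[abs_def] P'_def by (rule termdiffs_strong'[OF sm that])
  have P_cont: "isCont P x" if "norm x < 1 / T" for x
    using DERIV_isCont[OF P_deriv[OF that]] .
  have P'_cont: "isCont P' x" if "norm x < 1 / T" for x
    unfolding P'_def[abs_def] using DERIV_isCont[OF termdiffs_strong'[OF sm' that]] .
  have eq: "?\<Phi> t = t powr b * P (1 / t)" if "T < t" for t
    unfolding P_def using kernel_integral_expansion[OF that] .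
  have small: "norm (1 / t) < 1 / T" if "T < t" for t
    using that T by (simp add: frac_less2)
  have inv: "((\<lambda>t::real. 1 / t) \<longlongrightarrow> 0) at_top"
    using tendsto_inverse_0_at_top[OF filterlim_ident] by (simp add: inverse_eq_divide)
  have inv2: "((\<lambda>t::real. - 1 / t\<^sup>2) \<longlongrightarrow> 0) at_top"
    using tendsto_minus[OF tendsto_mult[OF inv inv]] by (simp add: power2_eq_square)
  have P0: "((\<lambda>t. P (1 / t)) \<longlongrightarrow> P 0) at_top" "((\<lambda>t. P' (1 / t)) \<longlongrightarrow> P' 0) at_top"
    using T by (auto intro!: isCont_tendsto_compose[OF P_cont inv] isCont_tendsto_compose[OF P'_cont inv])
  have pw: "((\<lambda>t::real. t powr c) \<longlongrightarrow> 0) at_top" if "c < 0" for c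
    by (rule tendsto_neg_powr[OF that filterlim_ident])
  show thesis
  proof
    show "(?\<Phi> has_real_derivative \<Phi>' t) (at t)" if t: "T < t" for t
    proof -
      have t0: "0 < t" using t T by simp
      have inv_deriv: "((\<lambda>t. 1 / t) has_real_derivative (- 1 / t\<^sup>2)) (at t)"
        using t0 by (auto intro!: derivative_eq_intros simp: power2_eq_square)
      have "((\<lambda>t. t powr b * P (1 / t)) has_real_derivative \<Phi>' t) (at t)"
        using DERIV_mult[OF has_real_derivative_powr[OF t0, of b]
            DERIV_chain2[OF P_deriv[OF small[OF t]] inv_deriv]]
        by (simp add: \<Phi>'_def add.commute mult_ac)
      moreover have "\<forall>\<^sub>F u in nhds t. ?\<Phi> u = u powr b * P (1 / u)"
        using eventually_nhds_in_open[of "{T<..}" t] t eq by (auto elim: eventually_mono)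
      ultimately show ?thesis by (subst DERIV_cong_ev[OF refl _ refl])
    qed
    show "isCont \<Phi>' t" if t: "T < t" for t
    proof -
      have t0: "t \<noteq> 0" using t T by simp
      have inv_cont: "isCont (\<lambda>t. 1 / t) t" using t0 by (intro continuous_intros)
      show ?thesis unfolding \<Phi>'_def
        by (intro continuous_intros isCont_o2[OF inv_cont P_cont] isCont_o2[OF inv_cont P'_cont] small[OF t])
           (use t0 in auto)
    qed
    have "(\<Phi>' \<longlongrightarrow> b * 0 * P 0 + 0 * (P' 0 * 0)) at_top"
      unfolding \<Phi>'_def by (intro tendsto_intros P0 inv2 pw) (use b in auto)
    then show "(\<Phi>' \<longlongrightarrow> 0) at_top" by simp
    have "((\<lambda>t. t powr b * P (1 / t)) \<longlongrightarrow> 0 * P 0) at_top"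
      by (intro tendsto_intros P0 pw) (use b in auto)
    moreover have "\<forall>\<^sub>F t in at_top. t powr b * P (1 / t) = ?\<Phi> t"
      using eventually_gt_at_top[of T] by eventually_elim (simp add: eq)
    ultimately show "(?\<Phi> \<longlongrightarrow> 0) at_top" by (simp add: tendsto_cong)
  qed
qed

end

section \<open>Fractional integrals of periodic functions\<close>

text \<open>
  On \<open>[0,T)\<close> the kernel is bounded away from 0, because \<open>(t - s) powr (- b)\<close> is at most \<open>t powr (- b)\<close>.
\<close>

lemma integrable_indicator_mult_of_kernel_integrable:
  fixes f :: "real \<Rightarrow> real"
  assumes b: "b < 0" and t: "T < t"
    and int: "set_integrable lebesgue {0..t} (\<lambda>s. (t - s) powr b * f s)"
  shows "integrable lebesgue (\<lambda>s. indicator {0..<T} s * f s)"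
proof -
  let ?g = "\<lambda>s. indicator {0..<T} s *\<^sub>R ((t - s) powr b * f s)"
  have "set_integrable lebesgue {0..<T} (\<lambda>s. (t - s) powr b * f s)"
    by (rule set_integrable_subset[OF int]) (use t in auto)
  then have g: "integrable lebesgue ?g" by (simp add: set_integrable_def)
  have "integrable lebesgue (\<lambda>s. \<bar>t - s\<bar> powr (- b) * ?g s)"
  proof (rule integrable_mult_bounded_on_support[OF g])
    show "?g s = 0" if "s \<notin> {0..<T}" for s using that by simp
    show "(\<lambda>s. \<bar>t - s\<bar> powr (- b)) \<in> borel_measurable lebesgue"
      by (rule measurable_completion) simp
    show "\<bar>\<bar>t - s\<bar> powr (- b)\<bar> \<le> t powr (- b)" if "s \<in> {0..<T}" for s
      using that t b by (auto intro!: powr_mono2)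
  qed
  also have "(\<lambda>s. \<bar>t - s\<bar> powr (- b) * ?g s) = (\<lambda>s. indicator {0..<T} s * f s)"
  proof
    fix s
    have "\<bar>t - s\<bar> powr (- b) * (t - s) powr b = 1" if "s < T"
      using that t by (simp add: powr_add[symmetric])
    then show "\<bar>t - s\<bar> powr (- b) * ?g s = indicator {0..<T} s * f s"
      by (auto simp: indicator_def simp flip: mult.assoc)
  qed
  finally show ?thesis .
qed

text \<open>
  The contribution of \<open>[T,t]\<close> to the integral is the whole integral at \<open>t - T\<close>, by the substitution
  \<open>s \<mapsto> T + s\<close> and periodicity of \<open>f\<close>. Only the part over the first period remains.
\<close>

lemma frac_int_difference:
  fixes f :: "real \<Rightarrow> real"
  assumes T: "0 < T" and t: "T < t" and per: "\<And>s. f (s + T) = f s"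
    and int: "set_integrable lebesgue {0..t} (\<lambda>s. (t - s) powr (\<beta> - 1) * f s)"
  shows "frac_int \<beta> f t - frac_int \<beta> f (t - T)
           = 1 / Gamma \<beta> * (\<integral>s. (t - s) powr (\<beta> - 1) * (indicator {0..<T} s * f s) \<partial>lebesgue)"
proof -
  let ?k = "\<lambda>s. (t - s) powr (\<beta> - 1) * f s"
  have "(LINT s:{0..t}|lebesgue. ?k s) = (LINT s:{0..<T} \<union> {T..t}|lebesgue. ?k s)"
    using T t by (simp add: ivl_disj_un)
  also have "\<dots> = (LINT s:{0..<T}|lebesgue. ?k s) + (LINT s:{T..t}|lebesgue. ?k s)"
    by (rule set_integral_Un; (rule set_integrable_subset[OF int])?) (use T t in auto)
  also have "(LINT s:{0..<T}|lebesgue. ?k s)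
      = (\<integral>s. (t - s) powr (\<beta> - 1) * (indicator {0..<T} s * f s) \<partial>lebesgue)"
    by (simp add: set_lebesgue_integral_def mult_ac)
  also have "(LINT s:{T..t}|lebesgue. ?k s)
      = (\<integral>s. indicator {T..t} (T + 1 * s) *\<^sub>R ?k (T + 1 * s) \<partial>lebesgue)"
    unfolding set_lebesgue_integral_def by (subst lebesgue_integral_real_affine[of 1 _ T]) simp_all
  also have "\<dots> = (LINT s:{0..t - T}|lebesgue. (t - T - s) powr (\<beta> - 1) * f s)"
    unfolding set_lebesgue_integral_def
    by (rule Bochner_Integration.integral_cong)
       (use per in \<open>auto simp: indicator_def algebra_simps\<close>)
  finally show ?thesis
    unfolding frac_int_def by (simp add: algebra_simps)
qed

lemma AE_zero_of_periodic:
  fixes f :: "real \<Rightarrow> real"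
  assumes T: "0 < T" and "periodic_fun_simple f T"
    and ae: "AE s in lebesgue. indicator {0..<T} s * f s = 0"
  shows "AE s in lebesgue. f s = 0"
proof -
  interpret periodic_fun_simple f T by fact
  have "AE s in lebesgue. \<forall>n::int. indicator {0..<T} (s + of_int n * T) * f (s + of_int n * T) = 0"
    unfolding AE_all_countable by (intro allI AE_lebesgue_translate[OF ae])
  then show ?thesis
  proof eventually_elim
    case (elim s)
    \<comment> \<open>The number of periods by which \<open>s\<close> has to be moved to reach \<open>[0,T)\<close>.\<close>
    define n where "n = - \<lfloor>s / T\<rfloor>"
    have "s + of_int n * T = T * frac (s / T)"
      using T by (simp add: n_def frac_def field_simps)
    then have "s + of_int n * T \<in> {0..<T}"
      using T frac_lt_1[of "s / T"] by simp
    with elim[rule_format, of n] show ?case by (simp add: plus_of_int)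
  qed
qed

lemma frac_int_eq_0:
  assumes "AE s in lebesgue. f s = 0"
  shows "frac_int \<beta> f t = 0"
proof -
  have "(LINT s:{0..t}|lebesgue. (t - s) powr (\<beta> - 1) * f s) = 0"
    unfolding set_lebesgue_integral_def
    by (rule integral_eq_zero_AE) (use assms in \<open>auto elim: eventually_mono\<close>)
  then show ?thesis by (simp add: frac_int_def)
qed

context
  fixes f :: "real \<Rightarrow> real" and T T' \<beta> :: real
  assumes T: "0 < T" and T': "0 < T'" and \<beta>: "0 < \<beta>" "\<beta> < 1"
    and per: "periodic_fun_simple f T" and defd: "frac_int_defined \<beta> f"
begin

private definition "window s = indicator {0..<T} s * f s"
text \<open>
  The trace that the first period leaves in the values of the fractional integral at later times.
\<close>

private definition "\<Phi> t = 1 / Gamma \<beta> * (\<integral>s. (t - s) powr (\<beta> - 1) * window s \<partial>lebesgue)"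

private lemma window_supp: "s \<notin> {0..T} \<Longrightarrow> window s = 0"
  by (auto simp: window_def indicator_def)

private lemma window_integrable: "integrable lebesgue window"
proof -
  \<comment> \<open>One point \<open>t > T\<close> of integrability is enough; if there were none, \<open>1 = 0\<close> would hold almost everywhere on \<open>t > T\<close>.\<close>
  have "\<exists>t. T < t \<and> set_integrable lebesgue {0..t} (\<lambda>s. (t - s) powr (\<beta> - 1) * f s)"
  proof (rule ccontr)
    assume "\<not> ?thesis"
    then have "AE t in lebesgue. T < t \<longrightarrow> (1::real) = 0"
      using defd T unfolding frac_int_defined_def by (auto elim: eventually_mono)
    from continuous_zero_of_AE_zero[OF _ _ this, of "T + 1"] show False by simp
  qed
  then show ?thesis
    using integrable_indicator_mult_of_kernel_integrable[of "\<beta> - 1" T _ f] \<beta>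
    by (auto simp: window_def[abs_def])
qed

private lemma AE_difference:
  "AE t in lebesgue. T < t \<longrightarrow> frac_int \<beta> f t - frac_int \<beta> f (t - T) = \<Phi> t"
  using defd unfolding frac_int_defined_def
proof eventually_elim
  case (elim t)
  interpret periodic_fun_simple f T by (rule per)
  show ?case
    using elim frac_int_difference[of T t f \<beta>, OF T _ plus_period] T
    by (auto simp: \<Phi>_def window_def)
qed

private lemma \<Phi>_derivative:
  obtains \<Phi>' where
    "\<And>t. T < t \<Longrightarrow> (\<Phi> has_real_derivative \<Phi>' t) (at t)"
    "\<And>t. T < t \<Longrightarrow> isCont \<Phi>' t" "(\<Phi>' \<longlongrightarrow> 0) at_top" "(\<Phi> \<longlongrightarrow> 0) at_top"
proof -
  have "\<beta> - 1 < 0" using \<beta> by simp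
  from kernel_integral_derivative[OF window_integrable window_supp T this] obtain D where
    D: "\<And>t. T < t \<Longrightarrow> ((\<lambda>t. \<integral>s. (t - s) powr (\<beta> - 1) * window s \<partial>lebesgue) has_real_derivative D t) (at t)"
    "\<And>t. T < t \<Longrightarrow> isCont D t" "(D \<longlongrightarrow> 0) at_top"
    "((\<lambda>t. \<integral>s. (t - s) powr (\<beta> - 1) * window s \<partial>lebesgue) \<longlongrightarrow> 0) at_top" by blast
  show thesis
  proof
    show "(\<Phi> has_real_derivative 1 / Gamma \<beta> * D t) (at t)" if "T < t" for t
      unfolding \<Phi>_def[abs_def] by (rule DERIV_cmult[OF D(1)[OF that]])
    show "isCont (\<lambda>t. 1 / Gamma \<beta> * D t) t" if "T < t" for t
      using D(2)[OF that] by (rule continuous_mult[OF continuous_const])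
    show "((\<lambda>t. 1 / Gamma \<beta> * D t) \<longlongrightarrow> 0) at_top"
      using D(3) by (rule tendsto_mult_right_zero)
    show "(\<Phi> \<longlongrightarrow> 0) at_top"
      unfolding \<Phi>_def[abs_def] using D(4) by (rule tendsto_mult_right_zero)
  qed
qed

private lemma AE_zero_of_\<Phi>_zero:
  assumes "\<And>t. T < t \<Longrightarrow> \<Phi> t = 0"
  shows "AE s in lebesgue. f s = 0"
proof -
  have "\<beta> - 1 \<notin> \<nat>"
    using \<beta> by (auto simp: Nats_def)
  moreover have "Gamma \<beta> \<noteq> 0" using Gamma_real_pos[OF \<beta>(1)] by simp
  ultimately have "AE s in lebesgue. window s = 0"
    using assms by (intro AE_zero_of_kernel_integral_zero[OF window_integrable window_supp T]) (auto simp: \<Phi>_def)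
  then show ?thesis
    unfolding window_def by (rule AE_zero_of_periodic[OF T per])
qed

lemma AE_zero_of_frac_int_periodic:
  assumes "ae_periodic T' (frac_int \<beta> f)"
  shows "AE s in lebesgue. f s = 0"
proof (rule \<Phi>_derivative)
  fix \<Phi>' assume D: "\<And>t. T < t \<Longrightarrow> (\<Phi> has_real_derivative \<Phi>' t) (at t)" and lim: "(\<Phi> \<longlongrightarrow> 0) at_top"
  show ?thesis
    using vanishing_of_AE_periodic_difference[OF less_imp_le[OF T] T' _ lim AE_difference assms]
      DERIV_isCont[OF D] by (blast intro: AE_zero_of_\<Phi>_zero)
qed

text \<open>
  The identity \<open>F u - F (u - T) = \<Phi> u\<close> holds for almost all \<open>u\<close> only, and \<open>F\<close> is differentiable only
  almost everywhere. At a point \<open>t\<close> such that \<open>F\<close> is differentiable at \<open>t\<close> and \<open>t - T\<close>,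
  \<open>derivative_zero_of_AE_zero\<close> still permits differentiating it. The result is \<open>\<Phi>' = 0\<close>; since \<open>\<Phi>\<close>
  is differentiable at every \<open>t > T\<close>, it is constant there, whatever \<open>F\<close> does.
\<close>

lemma AE_zero_of_deriv_frac_int_periodic:
  assumes diff: "AE t in lebesgue. 0 < t \<longrightarrow> frac_int \<beta> f differentiable (at t)"
    and per': "ae_periodic T' (deriv (frac_int \<beta> f))"
  shows "AE s in lebesgue. f s = 0"
proof (rule \<Phi>_derivative)
  let ?F = "frac_int \<beta> f"
  fix \<Phi>' assume D: "\<And>t. T < t \<Longrightarrow> (\<Phi> has_real_derivative \<Phi>' t) (at t)"
    and cont: "\<And>t. T < t \<Longrightarrow> isCont \<Phi>' t"
    and lim': "(\<Phi>' \<longlongrightarrow> 0) at_top" and lim: "(\<Phi> \<longlongrightarrow> 0) at_top"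
  have "AE t in lebesgue. T < t \<longrightarrow> deriv ?F t - deriv ?F (t - T) = \<Phi>' t"
    using diff AE_lebesgue_translate[OF diff, of "- T"]
  proof eventually_elim
    case (elim t)
    show ?case
    proof
      assume t: "T < t"
      have F: "(?F has_real_derivative deriv ?F u) (at u)" if "?F differentiable at u" for u
        using that by (metis DERIV_deriv_iff_real_differentiable)
      have F1: "(?F has_real_derivative deriv ?F t) (at t)"
        using F elim t T by simp
      have F2: "(?F has_real_derivative deriv ?F (t - T)) (at (t - T))"
        using F elim t T by simp
      have "((\<lambda>u. ?F (u - T)) has_real_derivative deriv ?F (t - T)) (at t)"
        using F2 DERIV_shift[of ?F "deriv ?F (t - T)" t "- T"] by simp
      with F1 D[OF t] have "((\<lambda>u. ?F u - ?F (u - T) - \<Phi> u) has_real_derivative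
          deriv ?F t - deriv ?F (t - T) - \<Phi>' t) (at t)"
        by (intro DERIV_diff)
      moreover have "AE u in lebesgue. T < u \<longrightarrow> ?F u - ?F (u - T) - \<Phi> u = 0"
        using AE_difference by eventually_elim simp
      ultimately show "deriv ?F t - deriv ?F (t - T) = \<Phi>' t"
        using derivative_zero_of_AE_zero[OF _ t] by fastforce
    qed
  qed
  from vanishing_of_AE_periodic_difference[OF less_imp_le[OF T] T' cont lim' this per']
  have D0: "(\<Phi> has_real_derivative 0) (at t)" if "T < t" for t
    using D[OF that] that by simp
  have "\<Phi> t = 0" if t: "T < t" for t
  proof -
    have "\<forall>\<^sub>F u in at_top. \<Phi> u = \<Phi> t"
      using eventually_gt_at_top[of t]
    proof eventually_elim
      case (elim u)
      show ?case
        by (rule DERIV_isconst_end[OF elim])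
           (use D0 t in \<open>auto intro!: continuous_at_imp_continuous_on DERIV_isCont[OF D0]\<close>)
    qed
    then have "(\<Phi> \<longlongrightarrow> \<Phi> t) at_top" by (rule tendsto_eventually)
    with lim show ?thesis using tendsto_unique trivial_limit_at_top_linorder by blast
  qed
  then show ?thesis by (rule AE_zero_of_\<Phi>_zero)
qed

end


section \<open>Fractional primitives and derivatives that are periodic\<close>

lemma periodic_deriv:
  fixes f :: "real \<Rightarrow> real"
  assumes "periodic_fun_simple f T"
  shows "periodic_fun_simple (deriv f) T"
proof
  interpret periodic_fun_simple f T by fact
  fix x
  have "(\<lambda>x. f (x + T)) = f" by (simp add: plus_period)
  then show "deriv f (x + T) = deriv f x"
    unfolding deriv_def DERIV_shift by simp
qed

theorem mainTheorem2:
  fixes f :: "real \<Rightarrow> real" and T T' \<alpha> :: real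
  assumes "0 < T" and "0 < \<alpha>" and "\<alpha> < 1"
    and "periodic_fun_simple f T"
    and "0 < T'"
  shows "(frac_int_defined \<alpha> f \<and> ae_periodic T' (frac_int \<alpha> f) \<longrightarrow>
            (AE t in lebesgue. f t = 0) \<and> (\<forall>t>0. frac_int \<alpha> f t = 0))
       \<and> (RL_deriv_defined \<alpha> f \<and> ae_periodic T' (RL_deriv \<alpha> f) \<longrightarrow>
            (AE t in lebesgue. f t = 0) \<and> (\<forall>t>0. RL_deriv \<alpha> f t = 0))
       \<and> (caputo_deriv_defined \<alpha> f \<and> ae_periodic T' (caputo_deriv \<alpha> f) \<longrightarrow>
            (AE t in lebesgue. deriv f t = 0) \<and> (\<forall>t>0. caputo_deriv \<alpha> f t = 0))"
proof (intro conjI impI; elim conjE)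
  assume "frac_int_defined \<alpha> f" "ae_periodic T' (frac_int \<alpha> f)"
  then show ae: "AE t in lebesgue. f t = 0"
    using AE_zero_of_frac_int_periodic assms by blast
  show "\<forall>t>0. frac_int \<alpha> f t = 0" using frac_int_eq_0[OF ae] by simp
next
  assume "RL_deriv_defined \<alpha> f" "ae_periodic T' (RL_deriv \<alpha> f)"
  then show ae: "AE t in lebesgue. f t = 0"
    using AE_zero_of_deriv_frac_int_periodic[of T T' "1 - \<alpha>" f] assms
    unfolding RL_deriv_defined_def RL_deriv_def[abs_def] by simp
  have "frac_int (1 - \<alpha>) f = (\<lambda>t. 0)" using frac_int_eq_0[OF ae] by (intro ext)
  then show "\<forall>t>0. RL_deriv \<alpha> f t = 0" by (simp add: RL_deriv_def)
next
  assume "caputo_deriv_defined \<alpha> f" "ae_periodic T' (caputo_deriv \<alpha> f)"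
  then show ae: "AE t in lebesgue. deriv f t = 0"
    using AE_zero_of_frac_int_periodic[of T T' "1 - \<alpha>" "deriv f"] assms
    unfolding caputo_deriv_defined_def caputo_deriv_def[abs_def] by (simp add: periodic_deriv)
  show "\<forall>t>0. caputo_deriv \<alpha> f t = 0" using frac_int_eq_0[OF ae] by (simp add: caputo_deriv_def)
qed

end
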